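(* Let $A$ be a totally ordered set. The plactic monoid $\mathbf{Pl}_A$ is isomorphic to the reduced structure monoid $\mathbf{M}(\mathbf{Row}_A,\sigma_R,\boldsymbol{e}_R)$ of the row braiding and to the reduced structure monoid $\mathbf{M}(\mathbf{Col}_A,\sigma_C,\boldsymbol{e}_C)$ of the column braiding.
   Context: An $A$-row is a non-decreasing word in $A^*$; an $A$-column is a strictly decreasing word; $\mathbf{Row}_A$, $\mathbf{Col}_A$ are the sets of all $A$-rows, resp. $A$-columns, including the empty word $\boldsymbol{e}_R$, resp. $\boldsymbol{e}_C$. For rows write $x_1\ldots x_s \succ_R y_1\ldots y_t$ if $s\le t$ and $x_i>y_i$ for all $i\le s$. A Young tableau is a finite sequence $(r_1,\dots,r_k)$ of non-empty rows with $r_1\succ_R\cdots\succ_R r_k$, drawn as left-justified rows with $r_1$ on top; columns of cells read top to bottom are $A$-columns. Non-empty rows/columns are identified with one-row/one-column tableaux, empty ones with the empty tableau $\emptyset$. Row reading $\mathcal{R}(T)=r_1\cdots r_k$. Right Schensted insertion of $x$ into $T$: if $T=\emptyset$ the result is $(x)$; if $x\ge$ the last letter of $r_k$, append $x$ to $r_k$; otherwise replace the leftmost letter $x'>x$ of $r_k$ by $x$ and insert $x'$ likewise into $(r_1,\dots,r_{k-1})$, keeping the modified bottom row below. Iterating gives $\mathcal{I}(T,w)$; $T\ast T'=\mathcal{I}(T,\mathcal{R}(T'))$. Row braiding: if $r_1\ast r_2$ has two rows, top $r_3$ and bottom $r_4$, then $\sigma_R(r_1,r_2)=(r_3,r_4)$;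 otherwise $\sigma_R(r_1,r_2)=(\boldsymbol{e}_R,r_1r_2)$. Column braiding: if $c_1\ast c_2$ has two columns, left $c_3$ and right $c_4$, then $\sigma_C(c_1,c_2)=(c_3,c_4)$; otherwise $\sigma_C(c_1,c_2)=(c_1c_2,\boldsymbol{e}_C)$. For a set $X$ with a map $\sigma\colon X^{\times 2}\to X^{\times2}$ and an element $1\in X$, the reduced structure monoid $\mathbf{M}(X,\sigma,1)$ is the monoid generated by $X$ subject to the relations $xy=y'x'$ whenever $\sigma(x,y)=(y',x')$, together with the relation identifying $1$ with the empty word. The Knuth equivalence $\sim$ on $A^*$ is the congruence generated by $xzy\sim zxy$ for $x\le y<z$ and $yxz\sim yzx$ for $x<y\le z$, and $\mathbf{Pl}_A=A^*/\!\sim$. *)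

theory Defs
  imports "HOL-Algebra.Group"
begin

section \<open>Monoid presentations\<close>

text \<open>The congruence on the free monoid \<open>lists X\<close> generated by the pairs of \<open>R\<close>.\<close>

inductive_set generated_congruence :: "'x set \<Rightarrow> ('x list \<times> 'x list) set \<Rightarrow> ('x list \<times> 'x list) set"
  for X :: "'x set" and R :: "('x list \<times> 'x list) set" where
  base: "(u, v) \<in> R \<Longrightarrow> u \<in> lists X \<Longrightarrow> v \<in> lists X \<Longrightarrow> (u, v) \<in> generated_congruence X R"
| refl: "u \<in> lists X \<Longrightarrow> (u, u) \<in> generated_congruence X R"
| sym: "(u, v) \<in> generated_congruence X R \<Longrightarrow> (v, u) \<in> generated_congruence X R"
| trans: "(u, v) \<in> generated_congruence X R \<Longrightarrow> (v, w) \<in> generated_congruence X R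
    \<Longrightarrow> (u, w) \<in> generated_congruence X R"
| append: "(u, v) \<in> generated_congruence X R \<Longrightarrow> (u', v') \<in> generated_congruence X R
    \<Longrightarrow> (u @ u', v @ v') \<in> generated_congruence X R"

definition presented_monoid :: "'x set \<Rightarrow> ('x list \<times> 'x list) set \<Rightarrow> 'x list set monoid" where
  "presented_monoid X R =
    \<lparr>carrier = lists X // generated_congruence X R,
     mult = (\<lambda>U V. \<Union>u\<in>U. \<Union>v\<in>V. generated_congruence X R `` {u @ v}),
     one = generated_congruence X R `` {[]}\<rparr>"

lemma generated_congruence_lists:
  "(u, v) \<in> generated_congruence X R \<Longrightarrow> u \<in> lists X \<and> v \<in> lists X"
  by (induction rule: generated_congruence.induct) auto

lemma equiv_generated_congruence: "equiv (lists X) (generated_congruence X R)"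
proof (rule equivI)
  show "generated_congruence X R \<subseteq> lists X \<times> lists X"
  proof (rule subrelI)
    fix u v assume "(u, v) \<in> generated_congruence X R"
    from generated_congruence_lists[OF this] show "(u, v) \<in> lists X \<times> lists X"
      by simp
  qed
  show "refl_on (lists X) (generated_congruence X R)"
    by (intro refl_onI generated_congruence.refl)
  show "sym (generated_congruence X R)"
    by (intro symI) (rule generated_congruence.sym)
  show "trans (generated_congruence X R)"
    by (intro transI) (rule generated_congruence.trans)
qed

lemma mult_presented_monoid:
  assumes "u \<in> lists X" "v \<in> lists X"
  shows "generated_congruence X R `` {u} \<otimes>\<^bsub>presented_monoid X R\<^esub> generated_congruence X R `` {v}
    = generated_congruence X R `` {u @ v}"
proof -
  have "congruent2 (generated_congruence X R) (generated_congruence X R)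
      (\<lambda>u v. generated_congruence X R `` {u @ v})"
    by (intro congruent2I' equiv_class_eq[OF equiv_generated_congruence]
        generated_congruence.append)
  from UN_equiv_class2[OF equiv_generated_congruence equiv_generated_congruence this assms]
  show ?thesis
    by (simp add: presented_monoid_def)
qed

lemma monoid_presented_monoid: "monoid (presented_monoid X R)"
proof -
  let ?c = "\<lambda>u. generated_congruence X R `` {u}" and ?M = "presented_monoid X R"
  have carr: "U \<in> carrier ?M \<longleftrightarrow> (\<exists>u\<in>lists X. U = ?c u)" for U
    by (auto simp: presented_monoid_def quotient_def)
  have one: "\<one>\<^bsub>?M\<^esub> = ?c []"
    by (simp add: presented_monoid_def)
  note m = mult_presented_monoid[where X = X and R = R]
  have app: "u @ v \<in> lists X" if "u \<in> lists X" "v \<in> lists X" for u v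
    using that by simp
  show ?thesis
  proof (rule monoidI)
    fix U V W
    assume "U \<in> carrier ?M"
    then obtain u where u: "u \<in> lists X" "U = ?c u"
      by (auto simp: carr)
    show "\<one>\<^bsub>?M\<^esub> \<otimes>\<^bsub>?M\<^esub> U = U" "U \<otimes>\<^bsub>?M\<^esub> \<one>\<^bsub>?M\<^esub> = U"
      using u by (simp_all add: one m)
    assume "V \<in> carrier ?M"
    then obtain v where v: "v \<in> lists X" "V = ?c v"
      by (auto simp: carr)
    show "U \<otimes>\<^bsub>?M\<^esub> V \<in> carrier ?M"
      unfolding carr u(2) v(2) m[OF u(1) v(1)] using app[OF u(1) v(1)] by blast
    assume "W \<in> carrier ?M"
    then obtain w where w: "w \<in> lists X" "W = ?c w"
      by (auto simp: carr)
    show "U \<otimes>\<^bsub>?M\<^esub> V \<otimes>\<^bsub>?M\<^esub> W = U \<otimes>\<^bsub>?M\<^esub> (V \<otimes>\<^bsub>?M\<^esub> W)"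
      unfolding u(2) v(2) w(2) m[OF u(1) v(1)] m[OF v(1) w(1)]
        m[OF app[OF u(1) v(1)] w(1)] m[OF u(1) app[OF v(1) w(1)]] append_assoc ..
  next
    show "\<one>\<^bsub>?M\<^esub> \<in> carrier ?M"
      unfolding one carr by blast
  qed
qed

definition reduced_structure_monoid :: "'x set \<Rightarrow> ('x \<times> 'x \<Rightarrow> 'x \<times> 'x) \<Rightarrow> 'x \<Rightarrow> 'x list set monoid" where
  "reduced_structure_monoid X \<sigma> e = presented_monoid X
    ({([x, y], [y', x']) | x y y' x'. x \<in> X \<and> y \<in> X \<and> \<sigma> (x, y) = (y', x')} \<union> {([e], [])})"

definition plactic_monoid :: "'a::linorder set \<Rightarrow> 'a list set monoid" where
  "plactic_monoid A = presented_monoid A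
    ({([x, z, y], [z, x, y]) | x y z. x \<in> A \<and> y \<in> A \<and> z \<in> A \<and> x \<le> y \<and> y < z}
     \<union> {([y, x, z], [y, z, x]) | x y z. x \<in> A \<and> y \<in> A \<and> z \<in> A \<and> x < y \<and> y \<le> z})"

section \<open>Rows, columns and Young tableaux\<close>

definition Rows :: "'a::linorder set \<Rightarrow> 'a list set" where
  "Rows A = {r \<in> lists A. sorted_wrt (\<le>) r}"

definition Cols :: "'a::linorder set \<Rightarrow> 'a list set" where
  "Cols A = {c \<in> lists A. sorted_wrt (>) c}"

definition row_dominates :: "'a::linorder list \<Rightarrow> 'a list \<Rightarrow> bool" (infix "\<succ>\<^sub>R" 50) where
  "r \<succ>\<^sub>R r' \<longleftrightarrow> length r \<le> length r' \<and> (\<forall>i<length r. r ! i > r' ! i)"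

text \<open>A tableau is the list of its rows, the top (shortest) row first. The empty list is the
  empty tableau.\<close>

definition tableaux :: "'a::linorder set \<Rightarrow> 'a list list set" where
  "tableaux A = {T \<in> lists (Rows A - {[]}). successively (\<succ>\<^sub>R) T}"

definition row_reading :: "'a list list \<Rightarrow> 'a list" where
  "row_reading T = concat T"

text \<open>The bottom row is the last entry of the list. The library function \<^const>\<open>transpose\<close> accepts
  rows of different lengths: its \<open>j\<close>-th entry lists, in order, the \<open>j\<close>-th letters of those rows
  that have one.\<close>

definition tableau_columns :: "'a list list \<Rightarrow> 'a list list" where
  "tableau_columns T = List.transpose T"

definition row_tableau :: "'a list \<Rightarrow> 'a list list" where
  "row_tableau r = (if r = [] then [] else [r])"

definition column_tableau :: "'a list \<Rightarrow> 'a list list" where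
  "column_tableau c = map (\<lambda>x. [x]) c"

lemma row_tableau_in_tableaux: "r \<in> Rows A \<Longrightarrow> row_tableau r \<in> tableaux A"
  by (simp add: row_tableau_def tableaux_def)

lemma column_tableau_in_tableaux: "c \<in> Cols A \<Longrightarrow> column_tableau c \<in> tableaux A"
proof -
  assume c: "c \<in> Cols A"
  then have "successively (>) c"
    by (simp add: Cols_def successively_if_sorted_wrt)
  then have "successively (\<succ>\<^sub>R) (column_tableau c)"
    by (simp add: column_tableau_def successively_map row_dominates_def)
  moreover have "column_tableau c \<in> lists (Rows A - {[]})"
    using c by (auto simp: column_tableau_def Cols_def Rows_def)
  ultimately show ?thesis
    by (simp add: tableaux_def)
qed

section \<open>Schensted insertion and the braidings\<close>

text \<open>If \<open>last r > x\<close>, then \<open>i\<close> is the position of the leftmost letter of the row \<open>r\<close> greater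
  than \<open>x\<close>.\<close>

function schensted_insert :: "'a::linorder list list \<Rightarrow> 'a \<Rightarrow> 'a list list" where
  "schensted_insert T x =
    (if T = [] then [[x]]
     else let r = last T in
       if last r \<le> x then butlast T @ [r @ [x]]
       else let i = length (takeWhile (\<lambda>z. z \<le> x) r) in
         schensted_insert (butlast T) (r ! i) @ [r[i := x]])"
  by auto
termination
  by (relation "measure (\<lambda>(T, x). length T)") auto

declare schensted_insert.simps [simp del]

definition schensted_insert_word :: "'a::linorder list list \<Rightarrow> 'a list \<Rightarrow> 'a list list" where
  "schensted_insert_word T w = foldl schensted_insert T w"

definition tableau_product :: "'a::linorder list list \<Rightarrow> 'a list list \<Rightarrow> 'a list list" where
  "tableau_product T T' = schensted_insert_word T (row_reading T')"

definition row_braiding :: "'a::linorder list \<times> 'a list \<Rightarrow> 'a list \<times> 'a list" where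
  "row_braiding = (\<lambda>(r\<^sub>1, r\<^sub>2).
    case tableau_product (row_tableau r\<^sub>1) (row_tableau r\<^sub>2) of
      [r\<^sub>3, r\<^sub>4] \<Rightarrow> (r\<^sub>3, r\<^sub>4)
    | _ \<Rightarrow> ([], r\<^sub>1 @ r\<^sub>2))"

definition column_braiding :: "'a::linorder list \<times> 'a list \<Rightarrow> 'a list \<times> 'a list" where
  "column_braiding = (\<lambda>(c\<^sub>1, c\<^sub>2).
    case tableau_columns (tableau_product (column_tableau c\<^sub>1) (column_tableau c\<^sub>2)) of
      [c\<^sub>3, c\<^sub>4] \<Rightarrow> (c\<^sub>3, c\<^sub>4)
    | _ \<Rightarrow> (c\<^sub>1 @ c\<^sub>2, []))"

end

theory Submission
  imports Defs
begin

text \<open>The isomorphisms send a letter to the one-letter row (column), and a row (column) to itself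
  viewed as a word. The latter respects the braiding relations since Schensted insertion does not
  change the Knuth class of the reading of a tableau, and since the row and the column readings of
  a two-column tableau are Knuth equivalent. Conversely, the Knuth relations hold in the structure
  monoids because each of them is a single braiding of a one-letter and a two-letter row (column),
  up to splitting the latter into its letters.\<close>

section \<open>Isomorphisms between presented monoids\<close>

lemma generated_congruence_append_left:
  "(u, v) \<in> generated_congruence X R \<Longrightarrow> w \<in> lists X
    \<Longrightarrow> (w @ u, w @ v) \<in> generated_congruence X R"
  by (intro generated_congruence.append generated_congruence.refl)

lemma generated_congruence_append_right:
  "(u, v) \<in> generated_congruence X R \<Longrightarrow> w \<in> lists X
    \<Longrightarrow> (u @ w, v @ w) \<in> generated_congruence X R"
  by (intro generated_congruence.append generated_congruence.refl)

lemma concat_map_in_lists: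
  assumes "\<And>x. x \<in> X \<Longrightarrow> f x \<in> lists Y" "u \<in> lists X"
  shows "concat (map f u) \<in> lists Y"
  using assms(2) by (induction u) (auto dest: assms(1))

text \<open>Replacing letters by words is a homomorphism of free monoids, so it is compatible with
  every closure rule of the congruence; only generating pairs need the assumption
  \<open>R\<close>.\<close>

lemma generated_congruence_concat_map:
  assumes f: "\<And>x. x \<in> X \<Longrightarrow> f x \<in> lists Y"
    and R: "\<And>u v. (u, v) \<in> R \<Longrightarrow> u \<in> lists X \<Longrightarrow> v \<in> lists X
      \<Longrightarrow> (concat (map f u), concat (map f v)) \<in> generated_congruence Y S"
    and uv: "(u, v) \<in> generated_congruence X R"
  shows "(concat (map f u), concat (map f v)) \<in> generated_congruence Y S"
  using uv
proof (induction rule: generated_congruence.induct)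
  case (base u v)
  then show ?case by (rule R)
next
  case (refl u)
  then show ?case by (intro generated_congruence.refl concat_map_in_lists[OF f])
next
  case (sym u v)
  then show ?case by (blast intro: generated_congruence.sym)
next
  case (trans u v w)
  then show ?case by (blast intro: generated_congruence.trans)
next
  case (append u v u' v')
  then show ?case by (simp add: generated_congruence.append)
qed

lemma generated_congruence_concat_map_id:
  assumes f: "\<And>x. x \<in> X \<Longrightarrow> f x \<in> lists Y"
    and gf: "\<And>x. x \<in> X \<Longrightarrow> (concat (map g (f x)), [x]) \<in> generated_congruence X R"
    and u: "u \<in> lists X"
  shows "(concat (map g (concat (map f u))), u) \<in> generated_congruence X R"
  using u
proof (induction u)
  case Nil
  then show ?case by (simp add: generated_congruence.refl)
next
  case (Cons x u)
  then show ?case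
    using generated_congruence.append[OF gf[of x] Cons.IH] by simp
qed

text \<open>The substitutions \<open>f\<close> and \<open>g\<close> descend to classes because they
  respect the relations; \<open>gf\<close> and \<open>fg\<close>, which concern generators only,
  make the induced maps inverse to each other.\<close>

lemma presented_monoid_iso:
  assumes f: "\<And>x. x \<in> X \<Longrightarrow> f x \<in> lists Y"
    and g: "\<And>y. y \<in> Y \<Longrightarrow> g y \<in> lists X"
    and R: "\<And>u v. (u, v) \<in> R \<Longrightarrow> u \<in> lists X \<Longrightarrow> v \<in> lists X
      \<Longrightarrow> (concat (map f u), concat (map f v)) \<in> generated_congruence Y S"
    and S: "\<And>u v. (u, v) \<in> S \<Longrightarrow> u \<in> lists Y \<Longrightarrow> v \<in> lists Y
      \<Longrightarrow> (concat (map g u), concat (map g v)) \<in> generated_congruence X R"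
    and gf: "\<And>x. x \<in> X \<Longrightarrow> (concat (map g (f x)), [x]) \<in> generated_congruence X R"
    and fg: "\<And>y. y \<in> Y \<Longrightarrow> (concat (map f (g y)), [y]) \<in> generated_congruence Y S"
  shows "presented_monoid X R \<cong> presented_monoid Y S"
proof -
  let ?cX = "\<lambda>u. generated_congruence X R `` {u}" and ?cY = "\<lambda>u. generated_congruence Y S `` {u}"
  let ?F = "\<lambda>u. concat (map f u)" and ?G = "\<lambda>u. concat (map g u)"
  \<comment> \<open>The union avoids choosing a representative: by \<open>congF\<close> below, all
    representatives of a class contribute the same set.\<close>
  define h where "h U = (\<Union>u\<in>U. ?cY (?F u))" for U
  define k where "k V = (\<Union>v\<in>V. ?cX (?G v))" for V
  have carX: "U \<in> carrier (presented_monoid X R) \<longleftrightarrow> (\<exists>u\<in>lists X. U = ?cX u)" for U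
    by (auto simp: presented_monoid_def quotient_def)
  have carY: "U \<in> carrier (presented_monoid Y S) \<longleftrightarrow> (\<exists>u\<in>lists Y. U = ?cY u)" for U
    by (auto simp: presented_monoid_def quotient_def)
  have FY: "?F u \<in> lists Y" if "u \<in> lists X" for u
    by (rule concat_map_in_lists[OF f that])
  have GX: "?G u \<in> lists X" if "u \<in> lists Y" for u
    by (rule concat_map_in_lists[OF g that])
  have congF: "congruent (generated_congruence X R) (\<lambda>u. ?cY (?F u))"
    by (intro congruentI equiv_class_eq[OF equiv_generated_congruence]
        generated_congruence_concat_map[OF f R])
  have congG: "congruent (generated_congruence Y S) (\<lambda>u. ?cX (?G u))"
    by (intro congruentI equiv_class_eq[OF equiv_generated_congruence]
        generated_congruence_concat_map[OF g S])
  have h: "h (?cX u) = ?cY (?F u)" if "u \<in> lists X" for u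
    unfolding h_def by (rule UN_equiv_class[OF equiv_generated_congruence congF that])
  have k: "k (?cY u) = ?cX (?G u)" if "u \<in> lists Y" for u
    unfolding k_def by (rule UN_equiv_class[OF equiv_generated_congruence congG that])
  have hom: "h \<in> hom (presented_monoid X R) (presented_monoid Y S)"
  proof (rule homI)
    fix U V
    assume "U \<in> carrier (presented_monoid X R)"
    then obtain u where u: "u \<in> lists X" "U = ?cX u" by (auto simp: carX)
    show "h U \<in> carrier (presented_monoid Y S)"
      unfolding u(2) h[OF u(1)] carY using FY[OF u(1)] by blast
    assume "V \<in> carrier (presented_monoid X R)"
    then obtain v where v: "v \<in> lists X" "V = ?cX v" by (auto simp: carX)
    have "u @ v \<in> lists X" using u v by simp
    then show "h (U \<otimes>\<^bsub>presented_monoid X R\<^esub> V) = h U \<otimes>\<^bsub>presented_monoid Y S\<^esub> h V"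
      unfolding u(2) v(2) mult_presented_monoid[OF u(1) v(1)] h[OF u(1)] h[OF v(1)]
        mult_presented_monoid[OF FY[OF u(1)] FY[OF v(1)]]
      by (simp only: h map_append concat_append)
  qed
  have "bij_betw h (carrier (presented_monoid X R)) (carrier (presented_monoid Y S))"
  proof (rule bij_betw_byWitness[where f' = k])
    show "\<forall>U\<in>carrier (presented_monoid X R). k (h U) = U"
    proof
      fix U assume "U \<in> carrier (presented_monoid X R)"
      then obtain u where u: "u \<in> lists X" "U = ?cX u" by (auto simp: carX)
      show "k (h U) = U"
        unfolding u(2) h[OF u(1)] k[OF FY[OF u(1)]]
        by (rule equiv_class_eq[OF equiv_generated_congruence
              generated_congruence_concat_map_id[OF f gf u(1)]])
    qed
    show "\<forall>V\<in>carrier (presented_monoid Y S). h (k V) = V"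
    proof
      fix V assume "V \<in> carrier (presented_monoid Y S)"
      then obtain v where v: "v \<in> lists Y" "V = ?cY v" by (auto simp: carY)
      show "h (k V) = V"
        unfolding v(2) k[OF v(1)] h[OF GX[OF v(1)]]
        by (rule equiv_class_eq[OF equiv_generated_congruence
              generated_congruence_concat_map_id[OF g fg v(1)]])
    qed
    show "h ` carrier (presented_monoid X R) \<subseteq> carrier (presented_monoid Y S)"
      by (rule hom_carrier[OF hom])
    show "k ` carrier (presented_monoid Y S) \<subseteq> carrier (presented_monoid X R)"
    proof (rule image_subsetI)
      fix V assume "V \<in> carrier (presented_monoid Y S)"
      then obtain v where v: "v \<in> lists Y" "V = ?cY v" by (auto simp: carY)
      show "k V \<in> carrier (presented_monoid X R)"
        unfolding v(2) k[OF v(1)] carX using GX[OF v(1)] by blast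
    qed
  qed
  with hom show ?thesis
    by (auto simp: is_iso_def iso_def)
qed

section \<open>Knuth equivalence and Schensted insertion\<close>

text \<open>Names the relation set written out in \<open>plactic_monoid\<close>.\<close>

definition knuth_relations :: "'a::linorder set \<Rightarrow> ('a list \<times> 'a list) set" where
  "knuth_relations A =
    {([x, z, y], [z, x, y]) | x y z. x \<in> A \<and> y \<in> A \<and> z \<in> A \<and> x \<le> y \<and> y < z}
     \<union> {([y, x, z], [y, z, x]) | x y z. x \<in> A \<and> y \<in> A \<and> z \<in> A \<and> x < y \<and> y \<le> z}"

abbreviation knuth :: "'a::linorder set \<Rightarrow> ('a list \<times> 'a list) set" where
  "knuth A \<equiv> generated_congruence A (knuth_relations A)"

lemma knuth_xzy:
  "x \<in> A \<Longrightarrow> y \<in> A \<Longrightarrow> z \<in> A \<Longrightarrow> x \<le> y \<Longrightarrow> y < z \<Longrightarrow> ([x, z, y], [z, x, y]) \<in> knuth A"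
  by (rule generated_congruence.base) (auto simp: knuth_relations_def)

lemma knuth_yzx:
  "x \<in> A \<Longrightarrow> y \<in> A \<Longrightarrow> z \<in> A \<Longrightarrow> x < y \<Longrightarrow> y \<le> z \<Longrightarrow> ([y, z, x], [y, x, z]) \<in> knuth A"
  by (rule generated_congruence.sym, rule generated_congruence.base)
    (auto simp: knuth_relations_def)

text \<open>The large letter \<open>z\<close> jumps left over one letter \<open>s\<close> at a time
  by s z x ~ z s x, which needs s <= x < z. After each jump the letter just passed takes over the
  role of \<open>x\<close>.\<close>

lemma knuth_bump_left:
  assumes "p \<in> lists A" "x \<in> A" "z \<in> A" "sorted_wrt (\<le>) (p @ [x])" "x < z"
  shows "(p @ [z, x], z # p @ [x]) \<in> knuth A"
  using assms
proof (induction p arbitrary: x rule: rev_induct)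
  case Nil
  then show ?case by (simp add: generated_congruence.refl)
next
  case (snoc s p)
  have s: "s \<in> A" "s \<le> x" "s < z" using snoc.prems by (auto simp: sorted_wrt_append)
  have "(p @ [s, z, x], p @ [z, s, x]) \<in> knuth A"
    using snoc.prems s by (intro generated_congruence_append_left knuth_xzy) auto
  moreover have "((p @ [z, s]) @ [x], (z # p @ [s]) @ [x]) \<in> knuth A"
    using snoc.prems s
    by (intro generated_congruence_append_right snoc.IH) (auto simp: sorted_wrt_append)
  ultimately show ?case
    by (auto intro: generated_congruence.trans)
qed

text \<open>The small letter \<open>x\<close> moves left over \<open>q\<close>, starting at its
  right end. Whenever it passes a letter \<open>t\<close>, the letter before \<open>t\<close> is
  greater than \<open>x\<close> and at most \<open>t\<close>, as \<open>knuth_yzx\<close>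
  requires.\<close>

lemma knuth_bump_right:
  assumes "q \<in> lists A" "x \<in> A" "z \<in> A" "sorted_wrt (\<le>) (z # q)" "x < z"
  shows "(z # q @ [x], z # x # q) \<in> knuth A"
  using assms
proof (induction q arbitrary: z)
  case Nil
  then show ?case by (simp add: generated_congruence.refl)
next
  case (Cons t q)
  have t: "t \<in> A" "q \<in> lists A" "sorted_wrt (\<le>) (t # q)" "x < t"
    using Cons.hyps Cons.prems by auto
  then have "([z] @ (t # q @ [x]), [z] @ (t # x # q)) \<in> knuth A"
    using Cons.prems by (intro generated_congruence_append_left Cons.IH) simp_all
  moreover have "([z, t, x] @ q, [z, x, t] @ q) \<in> knuth A"
    using Cons.prems t by (intro generated_congruence_append_right knuth_yzx) simp_all
  ultimately show ?case
    by (auto intro: generated_congruence.trans)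
qed

text \<open>One bump is a chain of Knuth moves: \<open>x\<close> travels left through
  \<open>q\<close> until it stands right after \<open>z\<close>, then \<open>z\<close> travels left
  through \<open>p\<close> and out of the row.\<close>

lemma knuth_bump:
  assumes "p @ z # q \<in> Rows A" "x \<in> A" "\<And>s. s \<in> set p \<Longrightarrow> s \<le> x" "x < z"
  shows "(p @ z # q @ [x], z # p @ x # q) \<in> knuth A"
proof -
  have "(p @ (z # q @ [x]), p @ (z # x # q)) \<in> knuth A"
    using assms by (intro generated_congruence_append_left knuth_bump_right)
      (auto simp: Rows_def sorted_wrt_append)
  moreover have "((p @ [z, x]) @ q, (z # p @ [x]) @ q) \<in> knuth A"
    using assms by (intro generated_congruence_append_right knuth_bump_left)
      (auto simp: Rows_def sorted_wrt_append)
  ultimately show ?thesis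
    by (auto intro: generated_congruence.trans)
qed

section \<open>Schensted insertion preserves the Knuth class\<close>

lemma schensted_insert_Nil: "schensted_insert [] x = [[x]]"
  by (subst schensted_insert.simps) simp

lemma schensted_insert_append:
  "last r \<le> x \<Longrightarrow> schensted_insert (T @ [r]) x = T @ [r @ [x]]"
  by (subst schensted_insert.simps) simp

text \<open>\<open>takeWhile\<close> stops exactly before \<open>z\<close>, so the replaced position
  is \<open>length p\<close>. Writing the row as \<open>p @ z # q\<close> removes the index from
  later arguments.\<close>

lemma schensted_insert_bump:
  assumes "\<And>s. s \<in> set p \<Longrightarrow> s \<le> x" "x < z" "x < last (z # q)"
  shows "schensted_insert (T @ [p @ z # q]) x = schensted_insert T z @ [p @ x # q]"
proof -
  have "takeWhile (\<lambda>s. s \<le> x) (p @ z # q) = p"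
    using assms by (simp add: takeWhile_append2)
  with assms show ?thesis
    by (subst schensted_insert.simps) (simp add: Let_def)
qed

text \<open>Weaker than being a tableau (only the first column has to decrease), but preserved by
  insertion and sufficient for the comparison of the readings.\<close>

definition pretableaux :: "'a::linorder set \<Rightarrow> 'a list list set" where
  "pretableaux A = {T \<in> lists (Rows A - {[]}). sorted_wrt (>) (map hd T)}"

lemma pretableaux_snoc:
  "T @ [r] \<in> pretableaux A \<longleftrightarrow>
    T \<in> pretableaux A \<and> r \<in> Rows A \<and> r \<noteq> [] \<and> (\<forall>s\<in>set T. hd r < hd s)"
  by (auto simp: pretableaux_def sorted_wrt_append)

text \<open>The middle conjunct bounds the new first column from below, which makes the induction on
  the rows go through.\<close>

lemma schensted_insert_pretableaux:
  assumes "T \<in> pretableaux A" "x \<in> A"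
  shows "schensted_insert T x \<in> pretableaux A
    \<and> (\<forall>b. b < x \<longrightarrow> (\<forall>s\<in>set T. b < hd s) \<longrightarrow> (\<forall>s\<in>set (schensted_insert T x). b < hd s))
    \<and> (concat T @ [x], concat (schensted_insert T x)) \<in> knuth A"
  using assms
proof (induction T arbitrary: x rule: rev_induct)
  case Nil
  then show ?case
    by (simp add: schensted_insert_Nil pretableaux_def Rows_def generated_congruence.refl)
next
  case (snoc r T)
  from snoc.prems have T: "T \<in> pretableaux A" and r: "r \<in> Rows A" "r \<noteq> []"
    and hds: "\<And>s. s \<in> set T \<Longrightarrow> hd r < hd s"
    by (auto simp: pretableaux_snoc)
  have TA: "concat T \<in> lists A"
    using T by (auto simp: pretableaux_def Rows_def in_lists_conv_set)
  have rA: "r \<in> lists A" and rs: "sorted_wrt (\<le>) r"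
    using r by (auto simp: Rows_def)
  show ?case
  proof (cases "last r \<le> x")
    case True
    have "s \<le> x" if "s \<in> set r" for s
    proof -
      have "sorted_wrt (\<le>) (butlast r @ [last r])" using rs r(2) by simp
      moreover have "s \<in> set (butlast r @ [last r])" using that r(2) by simp
      ultimately show ?thesis using True by (auto simp del: append_butlast_last_id simp: sorted_wrt_append)
    qed
    then have "r @ [x] \<in> Rows A"
      using rA rs snoc.prems(2) by (auto simp: Rows_def sorted_wrt_append)
    then show ?thesis
      using True T r hds TA rA snoc.prems(2)
      by (auto simp: schensted_insert_append pretableaux_snoc intro!: generated_congruence.refl)
  next
    case False
    \<comment> \<open>The row is split at its leftmost letter \<open>z\<close> above
      \<open>x\<close>, which exists because \<open>last r\<close> is above
      \<open>x\<close>.\<close>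
    define p where "p = takeWhile (\<lambda>s. s \<le> x) r"
    have px: "s \<le> x" if "s \<in> set p" for s
      using that unfolding p_def by (rule set_takeWhileD[THEN conjunct2])
    have "\<exists>s\<in>set r. \<not> s \<le> x" using False r(2) last_in_set by blast
    then have "dropWhile (\<lambda>s. s \<le> x) r \<noteq> []"
      by simp
    then obtain z q where zq: "dropWhile (\<lambda>s. s \<le> x) r = z # q"
      by (cases "dropWhile (\<lambda>s. s \<le> x) r") auto
    then have rpq: "r = p @ z # q"
      unfolding p_def by (metis takeWhile_dropWhile_id)
    have xz: "x < z"
      using zq by (metis dropWhile_eq_Cons_conv not_le)
    have zA: "z \<in> A" using rA rpq by simp
    have ins: "schensted_insert (T @ [r]) x = schensted_insert T z @ [p @ x # q]"
      unfolding rpq using False px xz rpq by (intro schensted_insert_bump) auto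
    note IH = snoc.IH[OF T zA]
    have row: "p @ x # q \<in> Rows A"
      using r rpq px xz snoc.prems(2) by (auto simp: Rows_def sorted_wrt_append)
    \<comment> \<open>The head changes only if \<open>p\<close> is empty, and then it drops from
      \<open>z\<close> to \<open>x\<close>.\<close>
    have hd_le: "hd (p @ x # q) \<le> hd r"
      using xz unfolding rpq by (cases p) auto
    have hd_x: "hd (p @ x # q) \<le> x"
      using px by (cases p) auto
    \<comment> \<open>The bound of the induction hypothesis is used with \<open>b\<close> the head
      of the new row: it is at most x < z, and at most \<open>hd r\<close>, hence below every head
      of \<open>T\<close>.\<close>
    have "\<forall>s\<in>set (schensted_insert T z). hd (p @ x # q) < hd s"
      using IH hds hd_le hd_x xz by (meson le_less_trans)
    then have pre: "schensted_insert (T @ [r]) x \<in> pretableaux A"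
      using IH row by (simp add: ins pretableaux_snoc)
    \<comment> \<open>The new bottom row starts with \<open>hd r\<close> or with \<open>x\<close>,
      both above \<open>b\<close>. For the other rows, b < x < z makes the induction hypothesis
      applicable with the same \<open>b\<close>.\<close>
    have low: "\<forall>s\<in>set (schensted_insert (T @ [r]) x). b < hd s"
      if b: "b < x" "\<forall>s\<in>set (T @ [r]). b < hd s" for b
    proof -
      have "b < hd (p @ x # q)"
        using b rpq by (cases p) auto
      moreover have "b < z" using b(1) xz by simp
      ultimately show ?thesis using IH b by (auto simp: ins)
    qed
    \<comment> \<open>The bottom row first emits \<open>z\<close> on its left; the rows of
      \<open>T\<close> then absorb it by the induction hypothesis.\<close>
    have "(concat T @ (p @ z # q @ [x]), concat T @ (z # p @ x # q)) \<in> knuth A"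
      using TA r(1) rpq px xz snoc.prems(2)
      by (intro generated_congruence_append_left knuth_bump) auto
    moreover have "((concat T @ [z]) @ (p @ x # q), concat (schensted_insert T z) @ (p @ x # q)) \<in> knuth A"
      using IH row by (intro generated_congruence_append_right) (auto simp: Rows_def)
    ultimately have "(concat (T @ [r]) @ [x], concat (schensted_insert (T @ [r]) x)) \<in> knuth A"
      unfolding ins by (simp add: rpq) (rule generated_congruence.trans)
    with pre low show ?thesis by blast
  qed
qed

lemma schensted_insert_word_pretableaux:
  assumes "T \<in> pretableaux A" "w \<in> lists A"
  shows "schensted_insert_word T w \<in> pretableaux A
    \<and> (concat T @ w, concat (schensted_insert_word T w)) \<in> knuth A"
  using assms
proof (induction w arbitrary: T)
  case Nil
  then have "concat T \<in> lists A"
    by (auto simp: pretableaux_def Rows_def in_lists_conv_set)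
  with Nil show ?case
    by (simp add: schensted_insert_word_def generated_congruence.refl)
next
  case (Cons x w)
  note 1 = schensted_insert_pretableaux[of T A x]
  have "((concat T @ [x]) @ w, concat (schensted_insert T x) @ w) \<in> knuth A"
    using 1 Cons.prems by (intro generated_congruence_append_right) auto
  with 1 Cons show ?case
    by (auto simp: schensted_insert_word_def intro: generated_congruence.trans)
qed

section \<open>Row and column readings of two-column tableaux\<close>

text \<open>The letter \<open>d\<close> walks right through the column: b d x ~ b x d holds because
  x < b <= d, and after the exchange \<open>x\<close> serves as the new \<open>b\<close>.\<close>

lemma knuth_move_down_column:
  assumes "b # c \<in> Cols A" "d \<in> A" "b \<le> d"
  shows "(b # d # c, b # c @ [d]) \<in> knuth A"
  using assms
proof (induction c arbitrary: b)
  case Nil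
  then show ?case by (simp add: Cols_def generated_congruence.refl)
next
  case (Cons x c)
  have "([b, d, x] @ c, [b, x, d] @ c) \<in> knuth A"
    using Cons.prems by (intro generated_congruence_append_right knuth_yzx) (auto simp: Cols_def)
  moreover have "([b] @ (x # d # c), [b] @ (x # c @ [d])) \<in> knuth A"
    using Cons.prems by (intro generated_congruence_append_left Cons.IH) (auto simp: Cols_def)
  ultimately show ?case
    by (auto intro: generated_congruence.trans)
qed

lemma concat_transpose_short_rows:
  "(\<And>r. r \<in> set T \<Longrightarrow> length r \<le> 1) \<Longrightarrow> concat (List.transpose T) = concat T"
proof (induction T)
  case (Cons r T)
  then have T: "\<And>r. r \<in> set T \<Longrightarrow> r = [] \<or> (\<exists>x. r = [x])"
    by (metis One_nat_def le_Suc_eq le_zero_eq length_0_conv length_Suc_conv list.set_intros(2))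
  show ?case
  proof (cases r)
    case Nil
    then show ?thesis using Cons by simp
  next
    case (Cons x xs)
    then have xs: "xs = []" using Cons.prems[of r] by simp
    have "concat (map (case_list [] (\<lambda>h t. [h])) T) = concat T"
      using T by (induction T) force+
    moreover have "List.transpose (concat (map (case_list [] (\<lambda>h t. [t])) T)) = []"
      unfolding transpose_empty using T by fastforce
    ultimately show ?thesis
      unfolding Cons xs by simp
  qed
qed simp

lemma transpose_Cons_columns:
  assumes "T \<noteq> []" "[] \<notin> set T"
  shows "List.transpose T = map hd T # List.transpose (map tl T)"
proof (cases T)
  case (Cons r T')
  then obtain x xs where r: "r = x # xs" using assms by (cases r) auto
  have "[] \<notin> set T'" using assms Cons by simp
  then have "concat (map (case_list [] (\<lambda>h t. [h])) T') = map hd T'"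
      "concat (map (case_list [] (\<lambda>h t. [t])) T') = map tl T'"
    by (induction T') (auto split: list.split)
  then show ?thesis by (simp add: Cons r)
qed (use assms in simp)

text \<open>The second word is the column reading. By induction the lower rows are already read by
  columns; it remains to move the second letter of the top row, if any, past the heads of all lower
  rows.\<close>

lemma knuth_two_column_reading:
  assumes "T \<in> pretableaux A" "\<And>r. r \<in> set T \<Longrightarrow> length r \<le> 2"
  shows "(concat T, map hd T @ concat (map tl T)) \<in> knuth A"
  using assms
proof (induction T)
  case Nil
  then show ?case by (simp add: generated_congruence.refl)
next
  case (Cons r T)
  have T: "T \<in> pretableaux A" and r: "r \<in> Rows A" "r \<noteq> []"
    and hds: "\<And>s. s \<in> set T \<Longrightarrow> hd s < hd r"
    using Cons.prems(1) by (auto simp: pretableaux_def)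
  have rA: "r \<in> lists A" using r by (simp add: Rows_def)
  have "set (tl s) \<subseteq> A" if "s \<in> set T" for s
    using T that list.set_sel(2)[of s] by (auto simp: pretableaux_def Rows_def)
  then have tlA: "concat (map tl T) \<in> lists A"
    by (auto simp: in_lists_conv_set)
  have col: "hd r # map hd T \<in> Cols A"
    using T r hds by (auto simp: pretableaux_def Cols_def Rows_def in_lists_conv_set)
  have IH: "(r @ concat T, r @ map hd T @ concat (map tl T)) \<in> knuth A"
    using Cons.prems(2) rA by (intro generated_congruence_append_left Cons.IH T) auto
  show ?case
  proof (cases "tl r")
    case Nil
    then have "r = [hd r]" using r(2) by (metis list.collapse)
    then show ?thesis using IH Nil
      by (metis append_Cons append_Nil concat.simps(2) list.simps(9))
  next
    case (Cons d ds)
    then have rd: "r = [hd r, d]"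
      using Cons.prems(2)[of r] r(2) by (cases r) auto
    have "((hd r # d # map hd T) @ concat (map tl T), (hd r # map hd T @ [d]) @ concat (map tl T)) \<in> knuth A"
    proof (intro generated_congruence_append_right knuth_move_down_column col tlA)
      show "d \<in> A" using rA rd by (metis Cons_in_lists_iff)
      have "sorted_wrt (\<le>) [hd r, d]" using r(1) rd by (simp add: Rows_def)
      then show "hd r \<le> d" by simp
    qed
    then have "(r @ map hd T @ concat (map tl T), map hd (r # T) @ concat (map tl (r # T))) \<in> knuth A"
      by (subst rd, subst (2) rd) simp
    with IH show ?thesis
      by (auto intro: generated_congruence.trans)
  qed
qed

lemma knuth_columns_reading:
  assumes "T \<in> pretableaux A" "tableau_columns T = [c, c']"
  shows "(concat T, c @ c') \<in> knuth A"
proof -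
  have ne: "T \<noteq> []" "[] \<notin> set T"
    using assms by (auto simp: tableau_columns_def pretableaux_def)
  have len: "length r \<le> 2" if "r \<in> set T" for r
  proof -
    \<comment> \<open>The number of columns is the maximal row length.\<close>
    have "length r \<le> length (List.transpose T)" if "r \<in> set T" for T :: "'a list list"
      using that unfolding length_transpose by (induction T) (auto simp: le_max_iff_disj)
    from this[OF that] show ?thesis using assms(2) by (simp add: tableau_columns_def)
  qed
  have "c @ c' = concat (List.transpose T)"
    using assms(2) by (simp add: tableau_columns_def)
  also have "\<dots> = map hd T @ concat (map tl T)"
  proof -
    \<comment> \<open>Beyond the first column each row has at most one letter left.\<close>
    have "concat (List.transpose (map tl T)) = concat (map tl T)"
      using len by (intro concat_transpose_short_rows) fastforce
    then show ?thesis by (simp add: transpose_Cons_columns[OF ne])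
  qed
  finally show ?thesis
    using knuth_two_column_reading[OF assms(1) len] by simp
qed

section \<open>The braidings\<close>

text \<open>Insertion keeps the Knuth class, which settles products with two rows. In the default
  branch the output concatenates to the input word itself.\<close>

lemma knuth_row_braiding:
  assumes "r\<^sub>1 \<in> Rows A" "r\<^sub>2 \<in> Rows A" "row_braiding (r\<^sub>1, r\<^sub>2) = (s\<^sub>1, s\<^sub>2)"
  shows "(r\<^sub>1 @ r\<^sub>2, s\<^sub>1 @ s\<^sub>2) \<in> knuth A"
proof -
  define P where "P = tableau_product (row_tableau r\<^sub>1) (row_tableau r\<^sub>2)"
  have "row_tableau r\<^sub>1 \<in> pretableaux A" "concat (row_tableau r\<^sub>1) = r\<^sub>1"
      "row_reading (row_tableau r\<^sub>2) = r\<^sub>2"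
    using assms by (auto simp: row_tableau_def pretableaux_def row_reading_def)
  then have "(r\<^sub>1 @ r\<^sub>2, concat P) \<in> knuth A"
    using schensted_insert_word_pretableaux[of "row_tableau r\<^sub>1" A r\<^sub>2] assms(2)
    by (simp add: P_def tableau_product_def Rows_def)
  moreover have "s\<^sub>1 @ s\<^sub>2 = r\<^sub>1 @ r\<^sub>2 \<or> P = [s\<^sub>1, s\<^sub>2]"
    using assms(3) by (auto simp: row_braiding_def simp flip: P_def split: list.splits)
  moreover have "(r\<^sub>1 @ r\<^sub>2, r\<^sub>1 @ r\<^sub>2) \<in> knuth A"
    using assms by (intro generated_congruence.refl) (simp add: Rows_def)
  ultimately show ?thesis by auto
qed

text \<open>The output consists of columns, whereas insertion is controlled along the row reading,
  so the two readings of the product have to be compared. The default branch again leaves the word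
  unchanged.\<close>

lemma knuth_column_braiding:
  assumes "c\<^sub>1 \<in> Cols A" "c\<^sub>2 \<in> Cols A" "column_braiding (c\<^sub>1, c\<^sub>2) = (d\<^sub>1, d\<^sub>2)"
  shows "(c\<^sub>1 @ c\<^sub>2, d\<^sub>1 @ d\<^sub>2) \<in> knuth A"
proof -
  define P where "P = tableau_product (column_tableau c\<^sub>1) (column_tableau c\<^sub>2)"
  have conc: "concat (column_tableau c) = c" for c :: "'a list"
    unfolding column_tableau_def by (induction c) auto
  have pre: "column_tableau c\<^sub>1 \<in> pretableaux A"
    using assms(1) by (auto simp: column_tableau_def pretableaux_def Cols_def Rows_def comp_def)
  have P: "(c\<^sub>1 @ c\<^sub>2, concat P) \<in> knuth A" "P \<in> pretableaux A"
    using schensted_insert_word_pretableaux[OF pre, of c\<^sub>2] assms(2)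
    by (simp_all add: P_def tableau_product_def row_reading_def conc Cols_def)
  have "d\<^sub>1 @ d\<^sub>2 = c\<^sub>1 @ c\<^sub>2 \<or> tableau_columns P = [d\<^sub>1, d\<^sub>2]"
    using assms(3) by (auto simp: column_braiding_def simp flip: P_def split: list.splits)
  moreover have "(c\<^sub>1 @ c\<^sub>2, c\<^sub>1 @ c\<^sub>2) \<in> knuth A"
    using assms by (intro generated_congruence.refl) (simp add: Cols_def)
  moreover have "(c\<^sub>1 @ c\<^sub>2, d\<^sub>1 @ d\<^sub>2) \<in> knuth A" if "tableau_columns P = [d\<^sub>1, d\<^sub>2]"
    using generated_congruence.trans[OF P(1) knuth_columns_reading[OF P(2) that]] .
  ultimately show ?thesis by auto
qed

section \<open>Explicit values of the braidings\<close>

text \<open>No letter is bumped, so the product has a single row. With the unit relation this splits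
  a row into its letters.\<close>

lemma row_braiding_snoc:
  assumes "r @ [x] \<in> Rows A" "r \<noteq> []"
  shows "row_braiding (r, [x]) = ([], r @ [x])"
proof -
  have "last r \<le> x" using assms by (simp add: Rows_def sorted_wrt_append)
  then show ?thesis
    using assms(2) schensted_insert_append[of r x "[]"]
    by (simp add: row_braiding_def tableau_product_def row_tableau_def row_reading_def
        schensted_insert_word_def)
qed

text \<open>Inserting \<open>y\<close> bumps \<open>z\<close> into a new top row; this braiding
  yields x z y ~ z x y.\<close>

lemma row_braiding_xz_y:
  "x \<le> y \<Longrightarrow> y < z \<Longrightarrow> row_braiding ([x, z], [y]) = ([z], [x, y])"
  using schensted_insert_bump[of "[x]" y z "[]" "[]"]
  by (simp add: row_braiding_def tableau_product_def row_tableau_def row_reading_def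
      schensted_insert_word_def schensted_insert_Nil)

text \<open>Here \<open>x\<close> bumps \<open>y\<close>; this braiding yields y x z ~ y z
  x.\<close>

lemma row_braiding_yz_x:
  "x < y \<Longrightarrow> y \<le> z \<Longrightarrow> row_braiding ([y, z], [x]) = ([y], [x, z])"
  using schensted_insert_bump[of "[]" x y "[z]" "[]"]
  by (simp add: row_braiding_def tableau_product_def row_tableau_def row_reading_def
      schensted_insert_word_def schensted_insert_Nil)

text \<open>The letter \<open>x\<close> bumps the bottom letter, which bumps the one above it, and
  so on: the column moves up by one cell and \<open>x\<close> takes the bottom.\<close>

lemma schensted_insert_column:
  "sorted_wrt (>) (c @ [x]) \<Longrightarrow> schensted_insert (column_tableau c) x = column_tableau (c @ [x])"
proof (induction c arbitrary: x rule: rev_induct)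
  case Nil
  then show ?case by (simp add: column_tableau_def schensted_insert_Nil)
next
  case (snoc y c)
  then have "x < y" "sorted_wrt (>) (c @ [y])" by (auto simp: sorted_wrt_append)
  with snoc.IH[of y] schensted_insert_bump[of "[]" x y "[]" "column_tableau c"]
  show ?case by (simp add: column_tableau_def)
qed

lemma column_braiding_snoc:
  assumes "c @ [x] \<in> Cols A"
  shows "column_braiding (c, [x]) = (c @ [x], [])"
proof -
  have "tableau_product (column_tableau c) (column_tableau [x]) = column_tableau (c @ [x])"
    using assms schensted_insert_column[of c x]
    by (simp add: Cols_def tableau_product_def row_reading_def schensted_insert_word_def
        column_tableau_def)
  moreover have "List.transpose (column_tableau (c @ [x])) = [c @ [x]]"
  proof -
    have "List.transpose (map tl (column_tableau (c @ [x]))) = []"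
      by (simp add: column_tableau_def transpose_empty)
    moreover have "map hd (column_tableau (c @ [x])) = c @ [x]"
      by (simp add: column_tableau_def comp_def)
    moreover have "column_tableau (c @ [x]) \<noteq> []" "[] \<notin> set (column_tableau (c @ [x]))"
      by (auto simp: column_tableau_def)
    ultimately show ?thesis by (simp add: transpose_Cons_columns)
  qed
  ultimately show ?thesis
    by (simp add: column_braiding_def tableau_columns_def)
qed

text \<open>First \<open>z\<close> extends the row of \<open>x\<close>, then \<open>y\<close> bumps
  \<open>z\<close>: the product has the row z above the row x y.\<close>

lemma column_braiding_x_zy:
  assumes "x \<le> y" "y < z"
  shows "column_braiding ([x], [z, y]) = ([z, x], [y])"
  using assms schensted_insert_append[of "[x]" z "[]"] schensted_insert_bump[of "[x]" y z "[]" "[]"]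
  by (simp add: column_braiding_def tableau_product_def column_tableau_def row_reading_def
      schensted_insert_word_def schensted_insert_Nil tableau_columns_def)

text \<open>First \<open>z\<close> extends the row of \<open>y\<close>, then \<open>x\<close> bumps
  \<open>y\<close>: the product has the row y above the row x z.\<close>

lemma column_braiding_y_zx:
  assumes "x < y" "y \<le> z"
  shows "column_braiding ([y], [z, x]) = ([y, x], [z])"
  using assms schensted_insert_append[of "[y]" z "[]"] schensted_insert_bump[of "[]" x y "[z]" "[]"]
  by (simp add: column_braiding_def tableau_product_def column_tableau_def row_reading_def
      schensted_insert_word_def schensted_insert_Nil tableau_columns_def)

section \<open>The structure monoids\<close>

text \<open>Names the relation set written out in \<open>reduced_structure_monoid\<close>.\<close>

definition structure_relations ::
    "'x set \<Rightarrow> ('x \<times> 'x \<Rightarrow> 'x \<times> 'x) \<Rightarrow> 'x \<Rightarrow> ('x list \<times> 'x list) set" where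
  "structure_relations X \<sigma> e =
    {([x, y], [y', x']) | x y y' x'. x \<in> X \<and> y \<in> X \<and> \<sigma> (x, y) = (y', x')} \<union> {([e], [])}"

lemma structure_relation:
  "\<sigma> (x, y) = (y', x') \<Longrightarrow> x \<in> X \<Longrightarrow> y \<in> X \<Longrightarrow> y' \<in> X \<Longrightarrow> x' \<in> X
    \<Longrightarrow> ([x, y], [y', x']) \<in> generated_congruence X (structure_relations X \<sigma> e)"
  by (rule generated_congruence.base) (auto simp: structure_relations_def)

lemma structure_relation_unit:
  "e \<in> X \<Longrightarrow> ([e], []) \<in> generated_congruence X (structure_relations X \<sigma> e)"
  by (rule generated_congruence.base) (auto simp: structure_relations_def)

lemma structure_relation_unit_left:
  assumes "\<sigma> (x, y) = (e, z)" "x \<in> X" "y \<in> X" "e \<in> X" "z \<in> X"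
  shows "([x, y], [z]) \<in> generated_congruence X (structure_relations X \<sigma> e)"
proof -
  have "([x, y], [e, z]) \<in> generated_congruence X (structure_relations X \<sigma> e)"
    using assms by (rule structure_relation)
  moreover have "([e] @ [z], [] @ [z]) \<in> generated_congruence X (structure_relations X \<sigma> e)"
    using assms by (intro generated_congruence_append_right structure_relation_unit) simp_all
  ultimately show ?thesis
    using generated_congruence.trans by fastforce
qed

lemma structure_relation_unit_right:
  assumes "\<sigma> (x, y) = (z, e)" "x \<in> X" "y \<in> X" "e \<in> X" "z \<in> X"
  shows "([x, y], [z]) \<in> generated_congruence X (structure_relations X \<sigma> e)"
proof -
  have "([x, y], [z, e]) \<in> generated_congruence X (structure_relations X \<sigma> e)"
    using assms by (intro structure_relation) simp_all
  moreover have "([z] @ [e], [z] @ []) \<in> generated_congruence X (structure_relations X \<sigma> e)"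
    using assms by (intro generated_congruence_append_left structure_relation_unit) simp_all
  ultimately show ?thesis
    using generated_congruence.trans by fastforce
qed

section \<open>A common criterion and its two instances\<close>

text \<open>On \<open>A\<close> the composite of the two substitutions is exactly the identity. On
  \<open>X\<close> it splits a word into its letters, which \<open>snoc\<close> undoes one letter at
  a time; \<open>prefix\<close> keeps this induction inside \<open>X\<close>.\<close>

lemma plactic_iso_structure_monoid:
  fixes A :: "'a::linorder set" and X :: "'a list set"
  assumes X: "X \<subseteq> lists A" "[] \<in> X" "\<And>x. x \<in> A \<Longrightarrow> [x] \<in> X"
    and prefix: "\<And>w x. w @ [x] \<in> X \<Longrightarrow> w \<in> X"
    and sound: "\<And>u v u' v'. u \<in> X \<Longrightarrow> v \<in> X \<Longrightarrow> \<sigma> (u, v) = (u', v')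
      \<Longrightarrow> (u @ v, u' @ v') \<in> knuth A"
    and snoc: "\<And>w x. w @ [x] \<in> X \<Longrightarrow> w \<noteq> []
      \<Longrightarrow> ([w, [x]], [w @ [x]]) \<in> generated_congruence X (structure_relations X \<sigma> [])"
    and xzy: "\<And>x y z. x \<in> A \<Longrightarrow> y \<in> A \<Longrightarrow> z \<in> A \<Longrightarrow> x \<le> y \<Longrightarrow> y < z
      \<Longrightarrow> ([[x], [z], [y]], [[z], [x], [y]])
        \<in> generated_congruence X (structure_relations X \<sigma> [])"
    and yxz: "\<And>x y z. x \<in> A \<Longrightarrow> y \<in> A \<Longrightarrow> z \<in> A \<Longrightarrow> x < y \<Longrightarrow> y \<le> z
      \<Longrightarrow> ([[y], [x], [z]], [[y], [z], [x]])
        \<in> generated_congruence X (structure_relations X \<sigma> [])"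
  shows "plactic_monoid A \<cong> reduced_structure_monoid X \<sigma> []"
proof -
  let ?f = "\<lambda>x. [[x]]" and ?g = "\<lambda>w. w :: 'a list"
  have "presented_monoid A (knuth_relations A) \<cong> presented_monoid X (structure_relations X \<sigma> [])"
  proof (rule presented_monoid_iso[where f = ?f and g = ?g])
    fix u v assume "(u, v) \<in> knuth_relations A"
    then show "(concat (map ?f u), concat (map ?f v))
        \<in> generated_congruence X (structure_relations X \<sigma> [])"
      using xzy yxz by (auto simp: knuth_relations_def)
  next
    fix u v assume "(u, v) \<in> structure_relations X \<sigma> []"
    then show "(concat (map ?g u), concat (map ?g v)) \<in> knuth A"
      using sound by (auto simp: structure_relations_def intro: generated_congruence.refl)
  next
    fix w assume "w \<in> X"
    then show "(concat (map ?f (?g w)), [w])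
        \<in> generated_congruence X (structure_relations X \<sigma> [])"
    proof (induction w rule: rev_induct)
      case Nil
      \<comment> \<open>The generator \<open>[]\<close> and the empty product differ as words over
        \<open>X\<close>; the unit relation identifies them.\<close>
      then show ?case
        using generated_congruence.sym[OF structure_relation_unit[OF X(2)]] by simp
    next
      case (snoc x w)
      have x: "[x] \<in> X" using snoc.prems X by auto
      show ?case
      proof (cases "w = []")
        case True
        then show ?thesis using x by (simp add: generated_congruence.refl)
      next
        case False
        \<comment> \<open>By induction \<open>w\<close> equals the product of its letters;
          \<open>assms(6)\<close> then glues the last letter \<open>x\<close> back on.\<close>
        have "(concat (map ?f w) @ [[x]], [w] @ [[x]])
            \<in> generated_congruence X (structure_relations X \<sigma> [])"
          using snoc prefix x by (intro generated_congruence_append_right) auto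
        then show ?thesis
          using generated_congruence.trans assms(6)[OF snoc.prems False] by fastforce
      qed
    qed
  qed (use X in \<open>auto intro: generated_congruence.refl\<close>)
  then show ?thesis
    by (simp add: plactic_monoid_def reduced_structure_monoid_def knuth_relations_def
        structure_relations_def)
qed

lemma plactic_iso_row_structure_monoid:
  "plactic_monoid A \<cong> reduced_structure_monoid (Rows A) row_braiding []"
proof (rule plactic_iso_structure_monoid)
  let ?E = "generated_congruence (Rows A) (structure_relations (Rows A) row_braiding [])"
  show snoc: "([w, [x]], [w @ [x]]) \<in> ?E" if "w @ [x] \<in> Rows A" "w \<noteq> []" for w x
    using that
    by (intro structure_relation_unit_left row_braiding_snoc[where A = A]) (auto simp: Rows_def sorted_wrt_append)
  fix x y z assume A: "x \<in> A" "y \<in> A" "z \<in> A"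
  note trans = generated_congruence.trans and sym = generated_congruence.sym
  {
    assume xyz: "x \<le> y" "y < z"
    \<comment> \<open>With joined letters in parentheses, the chain is x z y = (xz) y = z (xy) = z x
      y; the middle equality is the braiding.\<close>
    have 1: "([[x], [z]] @ [[y]], [[x, z]] @ [[y]]) \<in> ?E"
      using snoc[of "[x]" z] A xyz by (intro generated_congruence_append_right) (auto simp: Rows_def)
    have 2: "([[x, z], [y]], [[z], [x, y]]) \<in> ?E"
      using A xyz by (intro structure_relation row_braiding_xz_y) (auto simp: Rows_def)
    have 3: "([[z]] @ [[x], [y]], [[z]] @ [[x, y]]) \<in> ?E"
      using snoc[of "[x]" y] A xyz by (intro generated_congruence_append_left) (auto simp: Rows_def)
    show "([[x], [z], [y]], [[z], [x], [y]]) \<in> ?E"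
      using trans[OF trans[OF 1[simplified] 2] sym[OF 3[simplified]]] by simp
  }
  {
    assume xyz: "x < y" "y \<le> z"
    \<comment> \<open>The chain is y x z = y (xz) = (yz) x = y z x, with the braiding read backwards
      in the middle.\<close>
    have 1: "([[y]] @ [[x], [z]], [[y]] @ [[x, z]]) \<in> ?E"
      using snoc[of "[x]" z] A xyz by (intro generated_congruence_append_left) (auto simp: Rows_def)
    have 2: "([[y, z], [x]], [[y], [x, z]]) \<in> ?E"
      using A xyz by (intro structure_relation row_braiding_yz_x) (auto simp: Rows_def)
    have 3: "([[y], [z]] @ [[x]], [[y, z]] @ [[x]]) \<in> ?E"
      using snoc[of "[y]" z] A xyz by (intro generated_congruence_append_right) (auto simp: Rows_def)
    show "([[y], [x], [z]], [[y], [z], [x]]) \<in> ?E"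
      using trans[OF trans[OF 1[simplified] sym[OF 2]] sym[OF 3[simplified]]] by simp
  }
qed (auto simp: Rows_def sorted_wrt_append intro: knuth_row_braiding[unfolded Rows_def])

text \<open>The scheme for rows carries over, with decreasing pairs joined and the unit on the
  right.\<close>

lemma plactic_iso_column_structure_monoid:
  "plactic_monoid A \<cong> reduced_structure_monoid (Cols A) column_braiding []"
proof (rule plactic_iso_structure_monoid)
  let ?E = "generated_congruence (Cols A) (structure_relations (Cols A) column_braiding [])"
  show snoc: "([w, [x]], [w @ [x]]) \<in> ?E" if "w @ [x] \<in> Cols A" for w x
    using that
    by (intro structure_relation_unit_right column_braiding_snoc[where A = A]) (auto simp: Cols_def sorted_wrt_append)
  fix x y z assume A: "x \<in> A" "y \<in> A" "z \<in> A"
  note trans = generated_congruence.trans and sym = generated_congruence.sym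
  {
    assume xyz: "x \<le> y" "y < z"
    \<comment> \<open>The chain is x z y = x (zy) = (zx) y = z x y.\<close>
    have 1: "([[x]] @ [[z], [y]], [[x]] @ [[z, y]]) \<in> ?E"
      using snoc[of "[z]" y] A xyz by (intro generated_congruence_append_left) (auto simp: Cols_def)
    have 2: "([[x], [z, y]], [[z, x], [y]]) \<in> ?E"
      using A xyz by (intro structure_relation column_braiding_x_zy) (auto simp: Cols_def)
    have 3: "([[z], [x]] @ [[y]], [[z, x]] @ [[y]]) \<in> ?E"
      using snoc[of "[z]" x] A xyz by (intro generated_congruence_append_right) (auto simp: Cols_def)
    show "([[x], [z], [y]], [[z], [x], [y]]) \<in> ?E"
      using trans[OF trans[OF 1[simplified] 2] sym[OF 3[simplified]]] by simp
  }
  {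
    assume xyz: "x < y" "y \<le> z"
    \<comment> \<open>The chain is y x z = (yx) z = y (zx) = y z x, with the braiding read
      backwards.\<close>
    have 1: "([[y], [x]] @ [[z]], [[y, x]] @ [[z]]) \<in> ?E"
      using snoc[of "[y]" x] A xyz by (intro generated_congruence_append_right) (auto simp: Cols_def)
    have 2: "([[y], [z, x]], [[y, x], [z]]) \<in> ?E"
      using A xyz by (intro structure_relation column_braiding_y_zx) (auto simp: Cols_def)
    have 3: "([[y]] @ [[z], [x]], [[y]] @ [[z, x]]) \<in> ?E"
      using snoc[of "[z]" x] A xyz by (intro generated_congruence_append_left) (auto simp: Cols_def)
    show "([[y], [x], [z]], [[y], [z], [x]]) \<in> ?E"
      using trans[OF trans[OF 1[simplified] sym[OF 2]] sym[OF 3[simplified]]] by simp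
  }
qed (auto simp: Cols_def sorted_wrt_append intro: knuth_column_braiding[unfolded Cols_def])

theorem theorem4p12:
  fixes A :: "'a::linorder set"
  shows "plactic_monoid A \<cong> reduced_structure_monoid (Rows A) row_braiding []
    \<and> plactic_monoid A \<cong> reduced_structure_monoid (Cols A) column_braiding []"
  by (intro conjI plactic_iso_row_structure_monoid plactic_iso_column_structure_monoid)

end
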